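(* Let $G$ be a twin graph on $n=|V(G)|$ vertices and suppose that $n$ is even. Let $\pi^*=\{C_1,C_2,\ldots,C_t,\{v_{n-1}\},\{v_n\}\}$, with $t=\frac n2-1$, denote the twin partition of $G$. If the quotient graph $G_{\pi^*}$ has an almost equitable partition of the form $\rho=\{S_1,S_2,\ldots,S_m,\{\{v_{n-1}\},\{v_n\}\}\}$ (so that $\{S_1,\ldots,S_m\}$ is a partition of $\{C_1,\ldots,C_t\}$, and the two vertices $\{v_{n-1}\}$ and $\{v_n\}$ of $G_{\pi^*}$ together form one cell of $\rho$), then $G$ is strongly uncontrollable.
   Context: Graphs are finite. A weighted digraph is a triple $G=(V,E,\phi)$ with no loops, $E\subset V\times V$, and weight function $\phi$ on ordered pairs with values in $\{0,1,2,\ldots\}$ such that $\phi(u,v)\ne 0$ iff $(u,v)\in E$. A simple graph is one with $(u,v)\in E$ iff $(v,u)\in E$, all edge weights being $1$. For $u\in V$ and $C\subseteq V$, $\deg(u,C)=\sum_{v\in C}\phi(u,v)$ and $\deg(u)=\deg(u,V)$. The Laplacian matrix of a graph with vertices $v_1,\ldots,v_n$ is $L(G)=D-A$, where $A_{i,j}=\phi(v_i,v_j)$ and $D$ is the diagonal matrix of degrees $\deg(v_i)$. Almost equitable partition (AEP): a partition $\pi=\{C_1,\ldots,C_k\}$ of $V$ into nonempty cells is an AEP of $G$ if for all $i\ne j$, $\deg(u,C_j)=\deg(v,C_j)$ for all $u,v\in C_i$; this common value is denoted $\deg(C_i,C_j)$. The quotient graph $G_\pi$ is the weighted digraph with vertex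 set $\pi$ and weights $\phi(C_i,C_j)=\deg(C_i,C_j)$ for $i\neq j$ (an arc being present iff the weight is nonzero). Twins: in a simple graph $G$, with $N(u)$ the set of neighbors of $u$, two distinct vertices $u,v$ are twins if $N(u)\setminus\{v\}=N(v)\setminus\{u\}$. The number of twins of $G$ means the number of unordered twin pairs $\{u,v\}$. A matrix has simple spectrum if every eigenvalue has algebraic multiplicity one. A simple graph $G$ on $n$ vertices is a twin graph if $L(G)$ has simple spectrum and the number of twins of $G$ equals $t=\lfloor\frac{n-1}{2}\rfloor$ (the twin pairs are then pairwise disjoint). Twin partition: for a twin graph with $n$ even, the vertices are labeled so that the $t=\frac n2-1$ twin pairs are $C_1=\{v_1,v_2\},C_2=\{v_3,v_4\},\ldots,C_t=\{v_{n-3},v_{n-2}\}$, and $v_{n-1},v_n$ are the remaining (non-twin) vertices; the twin partition is $\pi^*=\{C_1,\ldots,C_t,\{v_{n-1}\},\{v_n\}\}$, which is an AEP of $G$. Controllability: for $L\in\mathbb{R}^{n\times n}$ and $b\in\mathbb{R}^n$, $(L,b)$ is controllable if $\mathrm{span}\{b,Lb,\ldots,L^{n-1}b\}=\mathbb{R}^n$, and uncontrollable otherwise. A simple connected graph $G$ on $n$ vertices is strongly uncontrollable if $L=L(G)$ has simple spectrum and $(L,b)$ is uncontrollable for every $b\in\{0,1\}^n$. *)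

theory Defs
  imports
    "HOL-Library.Disjoint_Sets"
    "Graph_Theory.Graph_Theory"
    "Jordan_Normal_Form.Char_Poly"
    "Jordan_Normal_Form.VS_Connect"
begin

section \<open>Weighted digraphs\<close>

record 'a wdigraph =
  base :: "'a pair_pre_digraph"
  weight :: "'a \<Rightarrow> 'a \<Rightarrow> nat"

abbreviation wverts :: "'a wdigraph \<Rightarrow> 'a set" where
  "wverts G \<equiv> pverts (base G)"

abbreviation warcs :: "'a wdigraph \<Rightarrow> 'a rel" where
  "warcs G \<equiv> parcs (base G)"

definition weighted_digraph :: "'a wdigraph \<Rightarrow> bool" where
  "weighted_digraph G \<longleftrightarrow>
     pair_digraph (base G) \<and>
     (\<forall>u\<in>wverts G. \<forall>v\<in>wverts G. weight G u v \<noteq> 0 \<longleftrightarrow> (u, v) \<in> warcs G)"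

definition simple_graph :: "'a wdigraph \<Rightarrow> bool" where
  "simple_graph G \<longleftrightarrow>
     weighted_digraph G \<and>
     (\<forall>u v. (u, v) \<in> warcs G \<longleftrightarrow> (v, u) \<in> warcs G) \<and>
     (\<forall>(u, v)\<in>warcs G. weight G u v = 1)"

definition connected_graph :: "'a wdigraph \<Rightarrow> bool" where
  "connected_graph G \<longleftrightarrow> Digraph_Component.connected (with_proj (base G))"

definition wdeg :: "'a wdigraph \<Rightarrow> 'a \<Rightarrow> 'a set \<Rightarrow> nat" where
  "wdeg G u C = (\<Sum>v\<in>C. weight G u v)"


section \<open>Almost equitable partitions and quotients\<close>

text \<open>\<^const>\<open>partition_on\<close> already requires the cells to be nonempty.\<close>

definition almost_equitable :: "'a wdigraph \<Rightarrow> 'a set set \<Rightarrow> bool" where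
  "almost_equitable G \<pi> \<longleftrightarrow>
     partition_on (wverts G) \<pi> \<and>
     (\<forall>C\<in>\<pi>. \<forall>D\<in>\<pi>. C \<noteq> D \<longrightarrow> (\<forall>u\<in>C. \<forall>v\<in>C. wdeg G u D = wdeg G v D))"

text \<open>The common value of the degrees into \<open>D\<close> of the vertices of \<open>C\<close>; it is only meaningful
  for distinct cells of an almost equitable partition.\<close>

definition cell_deg :: "'a wdigraph \<Rightarrow> 'a set \<Rightarrow> 'a set \<Rightarrow> nat" where
  "cell_deg G C D = (THE d. \<forall>u\<in>C. wdeg G u D = d)"

definition quotient_weight :: "'a wdigraph \<Rightarrow> 'a set \<Rightarrow> 'a set \<Rightarrow> nat" where
  "quotient_weight G C D = (if C = D then 0 else cell_deg G C D)"

definition quotient_graph :: "'a wdigraph \<Rightarrow> 'a set set \<Rightarrow> 'a set wdigraph" where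
  "quotient_graph G \<pi> =
     \<lparr> base = \<lparr> pverts = \<pi>,
                parcs = {(C, D). C \<in> \<pi> \<and> D \<in> \<pi> \<and> quotient_weight G C D \<noteq> 0} \<rparr>,
       weight = quotient_weight G \<rparr>"


section \<open>Laplacian matrix and simple spectrum\<close>

text \<open>A labelling \<open>v\<close> lists the vertices as \<open>v 1, \<dots>, v n\<close>, whereas matrix indices start
  at 0; hence the shift by \<^const>\<open>Suc\<close> below.\<close>

definition labelling :: "'a wdigraph \<Rightarrow> (nat \<Rightarrow> 'a) \<Rightarrow> bool" where
  "labelling G v \<longleftrightarrow> bij_betw v {1..card (wverts G)} (wverts G)"

definition adjacency_mat :: "'a wdigraph \<Rightarrow> (nat \<Rightarrow> 'a) \<Rightarrow> real mat" where
  "adjacency_mat G v = mat (card (wverts G)) (card (wverts G))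
     (\<lambda>(i, j). real (weight G (v (Suc i)) (v (Suc j))))"

definition degree_mat :: "'a wdigraph \<Rightarrow> (nat \<Rightarrow> 'a) \<Rightarrow> real mat" where
  "degree_mat G v = mat (card (wverts G)) (card (wverts G))
     (\<lambda>(i, j). if i = j then real (wdeg G (v (Suc i)) (wverts G)) else 0)"

definition laplacian :: "'a wdigraph \<Rightarrow> (nat \<Rightarrow> 'a) \<Rightarrow> real mat" where
  "laplacian G v = degree_mat G v - adjacency_mat G v"

definition simple_spectrum :: "real mat \<Rightarrow> bool" where
  "simple_spectrum A \<longleftrightarrow>
     (\<forall>z :: complex. eigenvalue (map_mat complex_of_real A) z \<longrightarrow>
        Polynomial.order z (char_poly (map_mat complex_of_real A)) = 1)"


section \<open>Twins\<close>

definition neighbours :: "'a wdigraph \<Rightarrow> 'a \<Rightarrow> 'a set" where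
  "neighbours G u = {w. (u, w) \<in> warcs G}"

definition twins :: "'a wdigraph \<Rightarrow> 'a \<Rightarrow> 'a \<Rightarrow> bool" where
  "twins G u v \<longleftrightarrow>
     u \<in> wverts G \<and> v \<in> wverts G \<and> u \<noteq> v \<and>
     neighbours G u - {v} = neighbours G v - {u}"

definition twin_pairs :: "'a wdigraph \<Rightarrow> 'a set set" where
  "twin_pairs G = {{u, v} | u v. twins G u v}"

text \<open>Relabelling the vertices conjugates the Laplacian by a permutation matrix, so the spectral
  conditions below do not depend on the labelling; a finite graph always has one. The floor is
  taken in the integers, so the empty graph (for which it is \<open>-1\<close>) is not a twin graph.\<close>

definition twin_graph :: "'a wdigraph \<Rightarrow> bool" where
  "twin_graph G \<longleftrightarrow>
     simple_graph G \<and>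
     (\<forall>v. labelling G v \<longrightarrow> simple_spectrum (laplacian G v)) \<and>
     int (card (twin_pairs G)) = \<lfloor>(real (card (wverts G)) - 1) / 2\<rfloor>"

definition twin_cell :: "(nat \<Rightarrow> 'a) \<Rightarrow> nat \<Rightarrow> 'a set" where
  "twin_cell v i = {v (2 * i - 1), v (2 * i)}"

text \<open>For a twin graph on an even number \<open>n\<close> of vertices: the first \<open>n - 2\<close> labels run through
  the twin pairs, so \<open>v (n - 1)\<close> and \<open>v n\<close> are the two vertices without a twin.\<close>

definition twin_labelling :: "'a wdigraph \<Rightarrow> (nat \<Rightarrow> 'a) \<Rightarrow> bool" where
  "twin_labelling G v \<longleftrightarrow>
     labelling G v \<and>
     twin_pairs G = twin_cell v ` {1..card (wverts G) div 2 - 1}"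

definition twin_partition :: "'a wdigraph \<Rightarrow> (nat \<Rightarrow> 'a) \<Rightarrow> 'a set set" where
  "twin_partition G v =
     (let n = card (wverts G)
      in twin_cell v ` {1..n div 2 - 1} \<union> {{v (n - 1)}, {v n}})"


section \<open>Controllability\<close>

text \<open>The span is the one of the locale \<^locale>\<open>vec_space\<close>.\<close>

definition controllable :: "nat \<Rightarrow> real mat \<Rightarrow> real vec \<Rightarrow> bool" where
  "controllable n L b \<longleftrightarrow>
     LinearCombinations.module.span class_ring (module_vec TYPE(real) n)
       {(L ^\<^sub>m k) *\<^sub>v b | k. k < n} = carrier_vec n"

definition strongly_uncontrollable :: "'a wdigraph \<Rightarrow> bool" where
  "strongly_uncontrollable G \<longleftrightarrow>
     simple_graph G \<and> connected_graph G \<and>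
     (\<forall>v. labelling G v \<longrightarrow>
        simple_spectrum (laplacian G v) \<and>
        (\<forall>b \<in> carrier_vec (card (wverts G)).
           (\<forall>i < card (wverts G). b $ i \<in> {0, 1}) \<longrightarrow>
           \<not> controllable (card (wverts G)) (laplacian G v) b))"

end

theory Submission
  imports Defs
begin

text \<open>Since \<open>L\<close> is symmetric, \<open>(L, b)\<close> is uncontrollable as soon as some nonzero \<open>w\<close> is orthogonal
to every \<open>L\<^sup>k b\<close>. Such a \<open>w\<close> is obtained from two almost equitable partitions \<open>\<pi>\<close> and \<open>\<rho>\<close> of \<open>G\<close>, for
each of which the functions constant on cells form an \<open>L\<close>-invariant space. Suppose that \<open>w\<close> is
constant on the cells of \<open>\<pi>\<close> and sums to zero over the cells of \<open>\<rho>\<close>, while \<open>b\<close> has the same cell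
sums over \<open>\<pi>\<close> as some \<open>y\<close> constant on the cells of \<open>\<rho>\<close>. Then
\<open>\<langle>w, L\<^sup>k b\<rangle> = \<langle>L\<^sup>k w, b\<rangle> = \<langle>L\<^sup>k w, y\<rangle> = \<langle>w, L\<^sup>k y\<rangle> = 0\<close>, by invariance of the first space in the
second step and of the second space in the last
(\<open>not_controllable_of_almost_equitable\<close>). No eigenvector has to be computed.

In the theorem, let \<open>p\<close> and \<open>q\<close> be the two vertices without a twin, and let \<open>\<rho>'\<close> be the partition
of \<open>G\<close> whose cells are the unions of the cells of the given partition of the quotient; it is again
almost equitable (\<open>almost_equitable_lift\<close>) and has \<open>{p, q}\<close> as a cell. A binary \<open>b\<close> falls under one
of three cases.

  \<^item> \<open>b\<close> agrees on some twins \<open>x\<close>, \<open>y\<close>. Take the singletons for \<open>\<pi>\<close>, the singletons with \<open>x\<close> and \<open>y\<close>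
    merged for \<open>\<rho>\<close>, and \<open>w = e\<^sub>x - e\<^sub>y\<close>.
  \<^item> \<open>b\<close> separates all twins and \<open>b p = b q\<close>. Then \<open>b\<close> has the cell sums of a function equal to
    \<open>1/2\<close> off \<open>{p, q}\<close>. Take the twin partition for \<open>\<pi>\<close>, \<open>\<rho>'\<close> for \<open>\<rho>\<close>, and \<open>w = e\<^sub>p - e\<^sub>q\<close>.
  \<^item> \<open>b\<close> separates all twins and \<open>b p \<noteq> b q\<close>. Then on every cell of \<open>\<rho>'\<close> half of the values of \<open>b\<close>
    are \<open>1\<close>. Take \<open>\<rho>'\<close> for \<open>\<pi>\<close>, the one-cell partition for \<open>\<rho>\<close>, and for \<open>w\<close> a combination of \<open>1\<close> and
    \<open>e\<^sub>p + e\<^sub>q\<close> with sum zero; it is nonzero because \<open>n > 2\<close>.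

Strong uncontrollability also includes connectedness, which follows from the simple spectrum: with
the vertices of a proper union of components labelled first, the Laplacian is block diagonal with
two singular blocks, so that \<open>0\<close> is at least a double root of the characteristic polynomial.\<close>

section \<open>The Laplacian as an operator on vertex functions\<close>

text \<open>The Laplacian acts on functions on the vertices, so that cells can be handled without reference
to a labelling. The form with differences makes the terms inside a cell on which \<open>f\<close> is constant vanish.\<close>

definition lap :: "'a wdigraph \<Rightarrow> ('a \<Rightarrow> real) \<Rightarrow> 'a \<Rightarrow> real" where
  "lap G f u = (\<Sum>v\<in>wverts G. real (weight G u v) * (f u - f v))"

definition lvec :: "'a wdigraph \<Rightarrow> (nat \<Rightarrow> 'a) \<Rightarrow> ('a \<Rightarrow> real) \<Rightarrow> real vec" where
  "lvec G v f = vec (card (wverts G)) (\<lambda>i. f (v (Suc i)))"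

lemma simple_graph_finite: "simple_graph G \<Longrightarrow> finite (wverts G)"
  by (auto simp: simple_graph_def weighted_digraph_def pair_digraph_def
      pair_fin_digraph_def pair_fin_digraph_axioms_def)

lemma simple_graph_arc_verts:
  "simple_graph G \<Longrightarrow> (u, w) \<in> warcs G \<Longrightarrow> u \<in> wverts G \<and> w \<in> wverts G"
  unfolding simple_graph_def weighted_digraph_def pair_digraph_def pair_fin_digraph_def
  by (auto dest: pair_wf_digraph.in_arcsD1 pair_wf_digraph.in_arcsD2)

lemma simple_graph_loopfree: "simple_graph G \<Longrightarrow> (u, u) \<notin> warcs G"
  by (force simp: simple_graph_def weighted_digraph_def pair_digraph_def
      dest: pair_loopfree_digraph.pair_no_loops)

lemma simple_graph_weight:
  assumes "simple_graph G" "u \<in> wverts G" "w \<in> wverts G"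
  shows "weight G u w = (if (u, w) \<in> warcs G then 1 else 0)"
proof (cases "(u, w) \<in> warcs G")
  case True
  then show ?thesis using assms by (auto simp: simple_graph_def)
next
  case False
  then have "weight G u w = 0"
    using assms unfolding simple_graph_def weighted_digraph_def by blast
  then show ?thesis using False by simp
qed

lemma simple_graph_weight_sym:
  assumes "simple_graph G" "u \<in> wverts G" "w \<in> wverts G"
  shows "weight G u w = weight G w u"
  using assms simple_graph_weight[of G u w] simple_graph_weight[of G w u]
  by (simp add: simple_graph_def)

lemma lap_selfadjoint:
  assumes G: "simple_graph G"
  shows "(\<Sum>u\<in>wverts G. f u * lap G g u) = (\<Sum>u\<in>wverts G. lap G f u * g u)"
proof -
  let ?V = "wverts G" and ?a = "\<lambda>u w. real (weight G u w)"
  have sym: "?a u w = ?a w u" if "u \<in> ?V" "w \<in> ?V" for u w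
    using simple_graph_weight_sym[OF G that] by simp
  have "(\<Sum>u\<in>?V. f u * lap G g u) - (\<Sum>u\<in>?V. lap G f u * g u)
      = (\<Sum>u\<in>?V. \<Sum>w\<in>?V. ?a u w * (f w * g u)) - (\<Sum>u\<in>?V. \<Sum>w\<in>?V. ?a u w * (f u * g w))"
    unfolding lap_def sum_distrib_left sum_distrib_right sum_subtractf[symmetric]
    by (intro sum.cong refl) (simp add: algebra_simps)
  also have "(\<Sum>u\<in>?V. \<Sum>w\<in>?V. ?a u w * (f w * g u)) = (\<Sum>w\<in>?V. \<Sum>u\<in>?V. ?a u w * (f w * g u))"
    by (rule sum.swap)
  also have "\<dots> = (\<Sum>w\<in>?V. \<Sum>u\<in>?V. ?a w u * (f w * g u))"
    by (intro sum.cong refl) (simp add: sym)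
  finally show ?thesis by simp
qed

lemma lap_funpow_selfadjoint:
  assumes G: "simple_graph G"
  shows "(\<Sum>u\<in>wverts G. f u * (lap G ^^ k) g u) = (\<Sum>u\<in>wverts G. (lap G ^^ k) f u * g u)"
proof (induction k arbitrary: f)
  case (Suc k)
  have "(\<Sum>u\<in>wverts G. f u * (lap G ^^ Suc k) g u) = (\<Sum>u\<in>wverts G. lap G f u * (lap G ^^ k) g u)"
    using lap_selfadjoint[OF G, of f "(lap G ^^ k) g"] by simp
  also have "\<dots> = (\<Sum>u\<in>wverts G. (lap G ^^ k) (lap G f) u * g u)" by (rule Suc)
  finally show ?case by (simp add: funpow_swap1)
qed simp

lemma sum_labelling:
  fixes h :: "'a \<Rightarrow> 'b :: comm_monoid_add"
  assumes "labelling G v"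
  shows "(\<Sum>i<card (wverts G). h (v (Suc i))) = (\<Sum>u\<in>wverts G. h u)"
proof -
  have "(\<Sum>i<card (wverts G). h (v (Suc i))) = (\<Sum>i\<in>{1..card (wverts G)}. h (v i))"
    by (simp add: sum.atLeast1_atMost_eq)
  also have "\<dots> = (\<Sum>u\<in>wverts G. h u)"
    using assms unfolding labelling_def by (intro sum.reindex_bij_betw)
  finally show ?thesis .
qed

lemma labelling_Suc_in_verts: "labelling G v \<Longrightarrow> i < card (wverts G) \<Longrightarrow> v (Suc i) \<in> wverts G"
  by (auto simp: labelling_def dest: bij_betwE)

lemma laplacian_carrier [simp]:
  "laplacian G v \<in> carrier_mat (card (wverts G)) (card (wverts G))"
  unfolding laplacian_def degree_mat_def adjacency_mat_def by (rule minus_carrier_mat) simp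

lemma laplacian_index:
  assumes "i < card (wverts G)" "j < card (wverts G)"
  shows "laplacian G v $$ (i, j) =
    (if i = j then real (wdeg G (v (Suc i)) (wverts G)) else 0)
      - real (weight G (v (Suc i)) (v (Suc j)))"
  using assms by (simp add: laplacian_def degree_mat_def adjacency_mat_def)

lemma laplacian_row_sum:
  assumes v: "labelling G v" and i: "i < card (wverts G)"
  shows "(\<Sum>j<card (wverts G). laplacian G v $$ (i, j) * f (v (Suc j))) = lap G f (v (Suc i))"
proof -
  let ?n = "card (wverts G)" and ?u = "v (Suc i)"
  have "(\<Sum>j<?n. laplacian G v $$ (i, j) * f (v (Suc j)))
      = (\<Sum>j<?n. (if j = i then real (wdeg G ?u (wverts G)) * f ?u else 0)
           - real (weight G ?u (v (Suc j))) * f (v (Suc j)))"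
    using i by (intro sum.cong refl) (auto simp: laplacian_index algebra_simps)
  also have "\<dots> = real (wdeg G ?u (wverts G)) * f ?u
      - (\<Sum>j<?n. real (weight G ?u (v (Suc j))) * f (v (Suc j)))"
    using i by (simp add: sum_subtractf)
  also have "\<dots> = real (wdeg G ?u (wverts G)) * f ?u - (\<Sum>w\<in>wverts G. real (weight G ?u w) * f w)"
    using sum_labelling[OF v, of "\<lambda>w. real (weight G ?u w) * f w"] by simp
  also have "\<dots> = lap G f ?u"
    by (simp add: lap_def wdeg_def sum_distrib_right sum_subtractf right_diff_distrib)
  finally show ?thesis .
qed

lemma laplacian_mult_lvec:
  assumes "labelling G v"
  shows "laplacian G v *\<^sub>v lvec G v f = lvec G v (lap G f)"
proof (rule eq_vecI)
  fix i assume "i < dim_vec (lvec G v (lap G f))"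
  then have i: "i < card (wverts G)" by (simp add: lvec_def)
  have "(laplacian G v *\<^sub>v lvec G v f) $ i
      = (\<Sum>j<card (wverts G). laplacian G v $$ (i, j) * f (v (Suc j)))"
    using i carrier_matD[OF laplacian_carrier[of G v]]
    by (simp add: scalar_prod_def lvec_def atLeast0LessThan)
  then show "(laplacian G v *\<^sub>v lvec G v f) $ i = lvec G v (lap G f) $ i"
    using i laplacian_row_sum[OF assms i] by (simp add: lvec_def)
qed (use carrier_matD[OF laplacian_carrier[of G v]] in \<open>simp add: lvec_def\<close>)

lemma lvec_carrier [simp]: "lvec G v f \<in> carrier_vec (card (wverts G))"
  by (simp add: lvec_def)

lemma laplacian_pow_mult_lvec:
  assumes "labelling G v"
  shows "(laplacian G v ^\<^sub>m k) *\<^sub>v lvec G v f = lvec G v ((lap G ^^ k) f)"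
proof (induction k arbitrary: f)
  case 0
  then show ?case using carrier_matD[OF laplacian_carrier[of G v]] by simp
next
  case (Suc k)
  have "(laplacian G v ^\<^sub>m Suc k) *\<^sub>v lvec G v f
      = (laplacian G v ^\<^sub>m k) *\<^sub>v (laplacian G v *\<^sub>v lvec G v f)"
    by (simp add: assoc_mult_mat_vec[OF pow_carrier_mat[OF laplacian_carrier] laplacian_carrier
          lvec_carrier])
  then show ?case using Suc[of "lap G f"] by (simp add: laplacian_mult_lvec[OF assms] funpow_swap1)
qed

lemma lvec_scalar_prod:
  assumes "labelling G v"
  shows "lvec G v f \<bullet> lvec G v g = (\<Sum>u\<in>wverts G. f u * g u)"
  using sum_labelling[OF assms, of "\<lambda>u. f u * g u"]
  by (simp add: scalar_prod_def lvec_def atLeast0LessThan)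


section \<open>Uncontrollability from two almost equitable partitions\<close>

lemma not_controllable_if_orthogonal:
  assumes L: "L \<in> carrier_mat n n" and b: "b \<in> carrier_vec n"
    and w: "w \<in> carrier_vec n" "w \<noteq> 0\<^sub>v n"
    and orth: "\<And>k. w \<bullet> ((L ^\<^sub>m k) *\<^sub>v b) = 0"
  shows "\<not> controllable n L b"
proof
  interpret V: vec_space "TYPE(real)" n .
  let ?K = "{(L ^\<^sub>m k) *\<^sub>v b | k. k < n}"
  let ?H = "{x \<in> carrier_vec n. w \<bullet> x = 0}"
  assume "controllable n L b"
  then have span: "V.span ?K = carrier_vec n" by (simp add: controllable_def)
  have "submodule class_ring ?H (module_vec TYPE(real) n)"
    unfolding submodule_def
    using w(1) V.module_axioms
    by (auto simp: module_vec_simps scalar_prod_add_distrib class_ring_simps)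
  moreover have "?K \<subseteq> ?H"
    using L b orth by (auto intro!: mult_mat_vec_carrier pow_carrier_mat)
  ultimately have "V.span ?K \<subseteq> ?H"
    by (rule V.span_is_subset[rotated])
  then have "w \<bullet> w = 0" using w(1) span by auto
  then have "(\<Sum>i\<in>{0..<n}. w $ i * w $ i) = 0" using w(1) by (simp add: scalar_prod_def)
  then have "\<forall>i\<in>{0..<n}. w $ i * w $ i = 0" by (subst (asm) sum_nonneg_eq_0_iff) auto
  then have "w = 0\<^sub>v n" using w(1) by (intro eq_vecI) auto
  then show False using w(2) by contradiction
qed

definition const_on_cells :: "'a set set \<Rightarrow> ('a \<Rightarrow> 'b) \<Rightarrow> bool" where
  "const_on_cells \<pi> f \<longleftrightarrow> (\<forall>C\<in>\<pi>. \<forall>u\<in>C. \<forall>v\<in>C. f u = f v)"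

lemma sum_over_cells:
  assumes "finite V" "partition_on V \<pi>"
  shows "(\<Sum>u\<in>V. h u) = (\<Sum>C\<in>\<pi>. \<Sum>u\<in>C. h u)"
proof -
  have "(\<Sum>u\<in>\<Union>\<pi>. h u) = (\<Sum>C\<in>\<pi>. \<Sum>u\<in>C. h u)"
    using assms
    by (subst sum.Union_disjoint) (auto simp: partition_on_def disjoint_def intro: finite_subset)
  then show ?thesis using assms by (simp add: partition_on_def)
qed

lemma const_orthogonal_to_zero_cell_sums:
  fixes f z :: "'a \<Rightarrow> real"
  assumes "finite V" "partition_on V \<pi>" "const_on_cells \<pi> f"
    and zero: "\<And>C. C \<in> \<pi> \<Longrightarrow> (\<Sum>u\<in>C. z u) = 0"
  shows "(\<Sum>u\<in>V. f u * z u) = 0"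
  unfolding sum_over_cells[OF assms(1,2)]
proof (rule sum.neutral, rule ballI)
  fix C assume C: "C \<in> \<pi>"
  then have "C \<noteq> {}" using assms(2) by (auto simp: partition_on_def)
  then obtain c where c: "c \<in> C" by blast
  have "(\<Sum>u\<in>C. f u * z u) = (\<Sum>u\<in>C. f c * z u)"
    using assms(3) C c unfolding const_on_cells_def by (intro sum.cong) metis+
  also have "\<dots> = 0" using zero[OF C] by (simp add: sum_distrib_left[symmetric])
  finally show "(\<Sum>u\<in>C. f u * z u) = 0" .
qed

text \<open>Inside a cell the differences \<open>f u - f w\<close> vanish, so the degrees within a cell, which may vary, drop
out; towards another cell \<open>f\<close> takes a single value, and only
the total degree into that cell enters.\<close>

lemma lap_const_on_cells:
  assumes G: "simple_graph G" and aep: "almost_equitable G \<pi>" and f: "const_on_cells \<pi> f"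
  shows "const_on_cells \<pi> (lap G f)"
  unfolding const_on_cells_def
proof (intro ballI)
  fix C x y assume C: "C \<in> \<pi>" and x: "x \<in> C" and y: "y \<in> C"
  have part: "partition_on (wverts G) \<pi>" using aep by (simp add: almost_equitable_def)
  have lap: "lap G f x = (\<Sum>D\<in>\<pi>. \<Sum>w\<in>D. real (weight G x w) * (f x - f w))" for x
    unfolding lap_def by (rule sum_over_cells[OF simple_graph_finite[OF G] part])
  have fxy: "f x = f y" using f C x y unfolding const_on_cells_def by blast
  have "(\<Sum>w\<in>D. real (weight G x w) * (f x - f w)) = (\<Sum>w\<in>D. real (weight G y w) * (f y - f w))"
    if D: "D \<in> \<pi>" for D
  proof (cases "D = C")
    case True
    have "f w = f y" if "w \<in> C" for w
      using f C y that unfolding const_on_cells_def by blast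
    then show ?thesis using True fxy by simp
  next
    case False
    have "D \<noteq> {}" using part D by (auto simp: partition_on_def)
    then obtain d where d: "d \<in> D" by blast
    have fd: "f w = f d" if "w \<in> D" for w using f D d that unfolding const_on_cells_def by blast
    have eq: "(\<Sum>w\<in>D. real (weight G z w) * (f z - f w)) = real (wdeg G z D) * (f z - f d)" for z
      unfolding wdeg_def of_nat_sum sum_distrib_right
      by (intro sum.cong refl) (simp add: fd)
    have "wdeg G x D = wdeg G y D"
      using aep C D x y False unfolding almost_equitable_def by blast
    then show ?thesis using eq[of x] eq[of y] fxy by simp
  qed
  then show "lap G f x = lap G f y" by (simp add: lap)
qed

lemma lap_funpow_const_on_cells:
  assumes "simple_graph G" "almost_equitable G \<pi>" "const_on_cells \<pi> f"
  shows "const_on_cells \<pi> ((lap G ^^ k) f)"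
  by (induction k) (use assms lap_const_on_cells in auto)

text \<open>The engine of the proof: \<open>b\<close> may be replaced by \<open>y\<close> when paired with functions constant on the
cells of \<open>\<pi>\<close>, and the iterates of \<open>y\<close> stay constant on the cells of \<open>\<rho>\<close>, where \<open>w\<close> cancels.\<close>

lemma not_controllable_of_almost_equitable:
  fixes w y b :: "'a \<Rightarrow> real"
  assumes G: "simple_graph G" and v: "labelling G v"
    and \<pi>: "almost_equitable G \<pi>" and \<rho>: "almost_equitable G \<rho>"
    and w: "const_on_cells \<pi> w" "\<And>C. C \<in> \<rho> \<Longrightarrow> (\<Sum>u\<in>C. w u) = 0"
    and nonzero: "z \<in> wverts G" "w z \<noteq> 0"
    and y: "const_on_cells \<rho> y" "\<And>C. C \<in> \<pi> \<Longrightarrow> (\<Sum>u\<in>C. b u - y u) = 0"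
  shows "\<not> controllable (card (wverts G)) (laplacian G v) (lvec G v b)"
proof (rule not_controllable_if_orthogonal)
  let ?V = "wverts G"
  have fin: "finite ?V" by (rule simple_graph_finite[OF G])
  have parts: "partition_on ?V \<pi>" "partition_on ?V \<rho>"
    using \<pi> \<rho> by (simp_all add: almost_equitable_def)
  show "lvec G v w \<noteq> 0\<^sub>v (card ?V)"
  proof
    assume 0: "lvec G v w = 0\<^sub>v (card ?V)"
    have "v ` {1..card ?V} = ?V"
      using v by (simp add: labelling_def bij_betw_def)
    then obtain i where "i \<in> {1..card ?V}" "z = v i"
      using nonzero(1) by blast
    then have "i - 1 < card ?V" "z = v (Suc (i - 1))" by auto
    then show False using arg_cong[OF 0, of "\<lambda>x. x $ (i - 1)"] nonzero(2) by (simp add: lvec_def)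
  qed
  fix k
  have wk: "const_on_cells \<pi> ((lap G ^^ k) w)"
    by (rule lap_funpow_const_on_cells[OF G \<pi> w(1)])
  have yk: "const_on_cells \<rho> ((lap G ^^ k) y)"
    by (rule lap_funpow_const_on_cells[OF G \<rho> y(1)])
  have "(\<Sum>u\<in>?V. w u * (lap G ^^ k) b u) = (\<Sum>u\<in>?V. (lap G ^^ k) w u * b u)"
    by (rule lap_funpow_selfadjoint[OF G])
  also have "\<dots> = (\<Sum>u\<in>?V. (lap G ^^ k) w u * y u)"
    using const_orthogonal_to_zero_cell_sums[OF fin parts(1) wk y(2)]
    by (simp add: algebra_simps sum_subtractf)
  also have "\<dots> = (\<Sum>u\<in>?V. w u * (lap G ^^ k) y u)"
    by (rule lap_funpow_selfadjoint[OF G, symmetric])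
  also have "\<dots> = 0"
    using const_orthogonal_to_zero_cell_sums[OF fin parts(2) yk w(2)] by (simp add: mult.commute)
  finally show "lvec G v w \<bullet> ((laplacian G v ^\<^sub>m k) *\<^sub>v lvec G v b) = 0"
    by (simp add: laplacian_pow_mult_lvec[OF v] lvec_scalar_prod[OF v])
qed simp_all


section \<open>Almost equitable partitions of a graph and of its quotient\<close>

lemma almost_equitable_trivial:
  assumes "wverts G \<noteq> {}"
  shows "almost_equitable G {wverts G}"
  using assms by (auto simp: almost_equitable_def partition_on_def)

lemma wdeg_Union:
  assumes "finite (wverts G)" "partition_on (wverts G) \<pi>" "S \<subseteq> \<pi>"
  shows "wdeg G u (\<Union>S) = (\<Sum>D\<in>S. wdeg G u D)"
proof -
  have "\<forall>A\<in>S. finite A"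
    using assms by (auto simp: partition_on_def intro: finite_subset)
  moreover have "disjoint S"
    using assms(2,3) unfolding partition_on_def disjoint_def by blast
  ultimately show ?thesis unfolding wdeg_def by (subst sum.Union_disjoint_sets) auto
qed

lemma cell_deg_eq:
  assumes "almost_equitable G \<pi>" "C \<in> \<pi>" "D \<in> \<pi>" "C \<noteq> D" "u \<in> C"
  shows "cell_deg G C D = wdeg G u D"
  unfolding cell_deg_def
proof (rule the_equality)
  show "\<forall>x\<in>C. wdeg G x D = wdeg G u D" using assms unfolding almost_equitable_def by blast
qed (use assms in auto)

text \<open>The degree of a vertex \<open>u\<close> into a union of cells is the sum of its degrees into these cells, which
is the degree of the cell of \<open>u\<close> in the quotient. The quotient loses the degrees within a cell of
\<open>\<pi>\<close>, but these lie within a cell of the union partition as well.\<close>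

lemma almost_equitable_lift:
  assumes G: "simple_graph G" and \<pi>: "almost_equitable G \<pi>"
    and \<rho>: "almost_equitable (quotient_graph G \<pi>) \<rho>"
  shows "almost_equitable G (\<Union> ` \<rho>)"
proof -
  have fin: "finite (wverts G)" by (rule simple_graph_finite[OF G])
  have p\<pi>: "partition_on (wverts G) \<pi>" using \<pi> by (simp add: almost_equitable_def)
  have p\<rho>: "partition_on \<pi> \<rho>" using \<rho> by (simp add: almost_equitable_def quotient_graph_def)
  have sub: "S \<subseteq> \<pi>" if "S \<in> \<rho>" for S using p\<rho> that by (auto simp: partition_on_def)
  have disj: "\<Union>S \<inter> \<Union>T = {}" if "S \<in> \<rho>" "T \<in> \<rho>" "S \<noteq> T" for S T
  proof -
    have "S \<inter> T = {}" using p\<rho> that by (auto simp: partition_on_def disjoint_def)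
    then have "A \<inter> B = {}" if "A \<in> S" "B \<in> T" for A B
      using that p\<pi> sub[OF \<open>S \<in> \<rho>\<close>] sub[OF \<open>T \<in> \<rho>\<close>]
      by (metis IntI disjointD empty_iff partition_on_def subsetD)
    then show ?thesis by blast
  qed
  have part: "partition_on (wverts G) (\<Union> ` \<rho>)"
  proof (rule partition_onI)
    show "\<Union> (\<Union> ` \<rho>) = wverts G" using p\<pi> p\<rho> by (simp add: partition_on_def) blast
    show "{} \<notin> \<Union> ` \<rho>"
    proof
      assume "{} \<in> \<Union> ` \<rho>"
      then obtain S where S: "S \<in> \<rho>" "\<Union>S = {}" by auto
      then have "S \<noteq> {}" using p\<rho> by (auto simp: partition_on_def)
      then obtain A where "A \<in> S" by blast
      moreover have "A \<noteq> {}" using calculation sub[OF S(1)] p\<pi> by (auto simp: partition_on_def)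
      ultimately show False using S(2) by blast
    qed
    show "disjnt p q" if pq: "p \<in> \<Union> ` \<rho>" "q \<in> \<Union> ` \<rho>" "p \<noteq> q" for p q
    proof -
      obtain S where S: "S \<in> \<rho>" "p = \<Union>S" using pq(1) by (rule imageE)
      obtain T where T: "T \<in> \<rho>" "q = \<Union>T" using pq(2) by (rule imageE)
      have "S \<noteq> T" using S T pq(3) by blast
      then show ?thesis using disj[OF S(1) T(1)] unfolding disjnt_def S(2) T(2) by blast
    qed
  qed
  have deg: "wdeg G u (\<Union>T) = wdeg (quotient_graph G \<pi>) A T"
    if "A \<in> \<pi>" "u \<in> A" "T \<in> \<rho>" "A \<notin> T" for A u T
  proof -
    have "wdeg G u (\<Union>T) = (\<Sum>D\<in>T. wdeg G u D)"
      by (rule wdeg_Union[OF fin p\<pi> sub[OF \<open>T \<in> \<rho>\<close>]])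
    also have "\<dots> = (\<Sum>D\<in>T. quotient_weight G A D)"
    proof (intro sum.cong refl)
      fix D assume "D \<in> T"
      then have "D \<in> \<pi>" "A \<noteq> D" using that sub by auto
      then show "wdeg G u D = quotient_weight G A D"
        using cell_deg_eq[OF \<pi> \<open>A \<in> \<pi>\<close> _ _ \<open>u \<in> A\<close>] by (simp add: quotient_weight_def)
    qed
    finally show ?thesis by (simp add: wdeg_def quotient_graph_def)
  qed
  show ?thesis unfolding almost_equitable_def
  proof (intro conjI ballI impI)
    fix C D x y assume "C \<in> \<Union> ` \<rho>" "D \<in> \<Union> ` \<rho>" "C \<noteq> D" and xy: "x \<in> C" "y \<in> C"
    then obtain S T where S: "S \<in> \<rho>" "C = \<Union>S" and T: "T \<in> \<rho>" "D = \<Union>T" and "S \<noteq> T" by auto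
    then obtain A B where A: "A \<in> S" "x \<in> A" and B: "B \<in> S" "y \<in> B" using xy by auto
    have "A \<notin> T" "B \<notin> T" using p\<rho> S T \<open>S \<noteq> T\<close> A B by (auto simp: partition_on_def disjoint_def)
    moreover have "A \<in> \<pi>" "B \<in> \<pi>" using sub[OF S(1)] A B by auto
    moreover have "wdeg (quotient_graph G \<pi>) A T = wdeg (quotient_graph G \<pi>) B T"
      using \<rho> S T \<open>S \<noteq> T\<close> A B unfolding almost_equitable_def by blast
    ultimately show "wdeg G x D = wdeg G y D" using deg A B T by simp
  qed (rule part)
qed

lemma twins_weight_eq:
  assumes G: "simple_graph G" and t: "twins G x y" and w: "w \<in> wverts G" "w \<noteq> x" "w \<noteq> y"
  shows "weight G x w = weight G y w"
proof -
  have "w \<in> neighbours G x \<longleftrightarrow> w \<in> neighbours G y" using t w by (auto simp: twins_def)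
  then show ?thesis
    using t w simple_graph_weight[OF G] by (simp add: twins_def neighbours_def)
qed

text \<open>Twins have the same weight to every vertex outside the pair, hence the same degree into every
other cell. Applied below both to the twin partition and to partitions with at most one cell
that is not a singleton.\<close>

lemma almost_equitable_of_twin_cells:
  assumes G: "simple_graph G" and part: "partition_on (wverts G) \<pi>"
    and twin: "\<And>C x y. C \<in> \<pi> \<Longrightarrow> x \<in> C \<Longrightarrow> y \<in> C \<Longrightarrow> x \<noteq> y \<Longrightarrow> twins G x y"
  shows "almost_equitable G \<pi>"
  unfolding almost_equitable_def
proof (intro conjI ballI impI)
  fix C D x y assume CD: "C \<in> \<pi>" "D \<in> \<pi>" "C \<noteq> D" and xy: "x \<in> C" "y \<in> C"
  show "wdeg G x D = wdeg G y D"
  proof (cases "x = y")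
    case False
    have "C \<inter> D = {}" "D \<subseteq> wverts G" using part CD by (auto simp: partition_on_def disjoint_def)
    then show ?thesis unfolding wdeg_def
      using twins_weight_eq[OF G twin[OF CD(1) xy False]] xy by (intro sum.cong refl) blast
  qed simp
qed (rule part)

lemma partition_on_singletons: "partition_on V ((\<lambda>x. {x}) ` V)"
  by (auto simp: partition_on_def disjoint_def)

lemma partition_on_pair_singletons:
  assumes "x \<in> V" "y \<in> V"
  shows "partition_on V (insert {x, y} ((\<lambda>u. {u}) ` (V - {x, y})))"
  using assms by (auto simp: partition_on_def disjoint_def)


section \<open>Simple spectrum forces connectedness\<close>

lemma eigenvalue_0_of_row_sums_0:
  fixes A :: "'a :: field mat"
  assumes A: "A \<in> carrier_mat m m" and m: "0 < m"
    and rows: "\<And>i. i < m \<Longrightarrow> (\<Sum>j<m. A $$ (i, j)) = 0"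
  shows "eigenvalue A 0"
proof -
  let ?e = "vec m (\<lambda>_. 1) :: 'a vec"
  have "?e \<noteq> 0\<^sub>v m"
    using m by (metis index_vec index_zero_vec(1) zero_neq_one)
  moreover have "A *\<^sub>v ?e = 0 \<cdot>\<^sub>v ?e"
  proof (rule eq_vecI)
    fix i assume "i < dim_vec (0 \<cdot>\<^sub>v ?e)"
    then show "(A *\<^sub>v ?e) $ i = (0 \<cdot>\<^sub>v ?e) $ i"
      using A rows[of i] by (simp add: scalar_prod_def atLeast0LessThan)
  qed (use A in simp)
  ultimately have "eigenvector A ?e 0" using A by (auto simp: eigenvector_def)
  then show ?thesis unfolding eigenvalue_def by blast
qed

text \<open>Both diagonal blocks inherit zero row sums, so each contributes a factor \<open>x\<close> to the
characteristic polynomial.\<close>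

lemma order_char_poly_block_diagonal:
  fixes A :: "'a :: field mat"
  assumes A: "A \<in> carrier_mat n n" and k: "0 < k" "k < n"
    and off: "\<And>i j. i < n \<Longrightarrow> j < n \<Longrightarrow> (i < k) \<noteq> (j < k) \<Longrightarrow> A $$ (i, j) = 0"
    and rows: "\<And>i. i < n \<Longrightarrow> (\<Sum>j<n. A $$ (i, j)) = 0"
  shows "2 \<le> Polynomial.order 0 (char_poly A)"
proof -
  define B where "B = mat k k (\<lambda>(i, j). A $$ (i, j))"
  define C where "C = mat (n - k) (n - k) (\<lambda>(i, j). A $$ (i + k, j + k))"
  have B: "B \<in> carrier_mat k k" and C: "C \<in> carrier_mat (n - k) (n - k)"
    by (simp_all add: B_def C_def)
  have split: "(\<Sum>j<n. f j) = (\<Sum>j<k. f j) + (\<Sum>j<n - k. f (j + k))" for f :: "nat \<Rightarrow> 'a"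
  proof -
    have "(\<Sum>j\<in>{0..<n}. f j) = (\<Sum>j\<in>{0..<k}. f j) + (\<Sum>j\<in>{k..<n}. f j)"
      using k by (intro sum.atLeastLessThan_concat[symmetric]) auto
    also have "(\<Sum>j\<in>{k..<n}. f j) = (\<Sum>j\<in>{0..<n - k}. f (j + k))"
      using sum.shift_bounds_nat_ivl[of f 0 k "n - k"] k by simp
    finally show ?thesis by (simp add: atLeast0LessThan)
  qed
  have "eigenvalue B 0"
  proof (rule eigenvalue_0_of_row_sums_0[OF B k(1)])
    fix i assume i: "i < k"
    have "(\<Sum>j<n - k. A $$ (i, j + k)) = 0" using i k by (intro sum.neutral) (auto intro!: off)
    then show "(\<Sum>j<k. B $$ (i, j)) = 0"
      using rows[of i] split[of "\<lambda>j. A $$ (i, j)"] i k by (simp add: B_def)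
  qed
  then have B0: "[:0, 1:] dvd char_poly B"
    using eigenvalue_root_char_poly[OF B, of 0] poly_eq_0_iff_dvd[of "char_poly B" 0] by simp
  have "eigenvalue C 0"
  proof (rule eigenvalue_0_of_row_sums_0[OF C])
    fix i assume i: "i < n - k"
    have "(\<Sum>j<k. A $$ (i + k, j)) = 0" using i k by (intro sum.neutral) (auto intro!: off)
    then show "(\<Sum>j<n - k. C $$ (i, j)) = 0"
      using rows[of "i + k"] split[of "\<lambda>j. A $$ (i + k, j)"] i k by (simp add: C_def)
  qed (use k in simp)
  then have C0: "[:0, 1:] dvd char_poly C"
    using eigenvalue_root_char_poly[OF C, of 0] poly_eq_0_iff_dvd[of "char_poly C" 0] by simp
  have "char_poly_matrix A
      = four_block_mat (char_poly_matrix B) (0\<^sub>m k (n - k)) (0\<^sub>m (n - k) k) (char_poly_matrix C)"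
    (is "_ = ?M")
  proof (rule eq_matI)
    fix i j assume "i < dim_row ?M" "j < dim_col ?M"
    then have ij: "i < n" "j < n" using B C k by (auto simp: char_poly_matrix_def)
    then show "char_poly_matrix A $$ (i, j) = ?M $$ (i, j)"
      using A B C k off[of i j]
      by (cases "i < k"; cases "j < k") (auto simp: char_poly_matrix_def B_def C_def)
  qed (use A B C k in \<open>auto simp: char_poly_matrix_def\<close>)
  then have "char_poly A = char_poly B * char_poly C"
    using B C by (simp add: char_poly_def
        det_four_block_mat_upper_right_zero[of _ k "0\<^sub>m k (n - k)" "n - k"])
  then have "[:0, 1:] ^ 2 dvd char_poly A"
    using mult_dvd_mono[OF B0 C0] by (simp add: power2_eq_square)
  moreover have "char_poly A \<noteq> 0"
    using degree_monic_char_poly[OF A] by auto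
  ultimately show ?thesis using order_divides[of 0 2 "char_poly A"] by simp
qed

lemma disconnected_vertex_set:
  assumes G: "simple_graph G" and ne: "wverts G \<noteq> {}" and disc: "\<not> connected_graph G"
  obtains S where "S \<subseteq> wverts G" "S \<noteq> {}" "S \<noteq> wverts G"
    "\<And>x y. x \<in> S \<Longrightarrow> y \<in> wverts G - S \<Longrightarrow> (x, y) \<notin> warcs G \<and> (y, x) \<notin> warcs G"
proof -
  let ?H = "with_proj (mk_symmetric (with_proj (base G)))"
  have H: "verts ?H = wverts G" "arcs_ends ?H = (\<Union>e\<in>warcs G. {e, (snd e, fst e)})"
    by (auto simp: parcs_mk_symmetric)
  obtain u z where uz: "u \<in> wverts G" "z \<in> wverts G" "\<not> u \<rightarrow>\<^sup>*\<^bsub>?H\<^esub> z"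
    using ne disc H unfolding connected_graph_def connected_def strongly_connected_def by auto
  \<comment> \<open>the component of \<open>u\<close>\<close>
  define S where "S = {x \<in> wverts G. u \<rightarrow>\<^sup>*\<^bsub>?H\<^esub> x}"
  show ?thesis
  proof
    show "S \<subseteq> wverts G" by (auto simp: S_def)
    show "S \<noteq> {}" using uz(1) by (auto simp: S_def reachable_def H(1))
    show "S \<noteq> wverts G" using uz by (auto simp: S_def)
    fix x y assume x: "x \<in> S" and y: "y \<in> wverts G - S"
    have "(x, y) \<notin> arcs_ends ?H"
    proof
      assume arc: "(x, y) \<in> arcs_ends ?H"
      have path: "(u, x) \<in> rtrancl_on (verts ?H) (arcs_ends ?H)"
        using x unfolding S_def reachable_def by blast
      have "y \<in> verts ?H" using y unfolding H(1) by blast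
      then have "u \<rightarrow>\<^sup>*\<^bsub>?H\<^esub> y"
        unfolding reachable_def by (rule rtrancl_on_into_rtrancl_on[OF path arc])
      then show False using y by (simp add: S_def)
    qed
    then show "(x, y) \<notin> warcs G \<and> (y, x) \<notin> warcs G" unfolding H(2) by force
  qed
qed

lemma ex_labelling_initial_segment:
  assumes "finite (wverts G)" "S \<subseteq> wverts G"
  obtains v where "labelling G v" "\<And>i. i \<in> {1..card (wverts G)} \<Longrightarrow> v i \<in> S \<longleftrightarrow> i \<le> card S"
proof -
  let ?V = "wverts G" and ?k = "card S"
  have fin: "finite S" "finite (?V - S)" using assms finite_subset by auto
  have le: "?k \<le> card ?V" using assms by (rule card_mono)
  have c: "card (?V - S) = card ?V - ?k" using assms fin by (intro card_Diff_subset)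
  obtain f where f: "bij_betw f {1..?k} S" using ex_bij_betw_nat_finite_1[OF fin(1)] by blast
  obtain g where g: "bij_betw g {1..card ?V - ?k} (?V - S)"
    using ex_bij_betw_nat_finite_1[OF fin(2)] unfolding c by blast
  define v where "v i = (if i \<le> ?k then f i else g (i - ?k))" for i
  have "bij_betw (\<lambda>i. i - ?k) {?k + 1..card ?V} {1..card ?V - ?k}"
    by (rule bij_betw_byWitness[where f' = "\<lambda>i. i + ?k"]) (use le in auto)
  then have "bij_betw (g \<circ> (\<lambda>i. i - ?k)) {?k + 1..card ?V} (?V - S)"
    using g by (rule bij_betw_trans)
  then have v2: "bij_betw v {?k + 1..card ?V} (?V - S)"
    by (subst bij_betw_cong[where g = "g \<circ> (\<lambda>i. i - ?k)"]) (auto simp: v_def)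
  have v1: "bij_betw v {1..?k} S"
    using f by (subst bij_betw_cong[where g = f]) (auto simp: v_def)
  have "bij_betw v ({1..?k} \<union> {?k + 1..card ?V}) (S \<union> (?V - S))"
    using v1 v2 by (rule bij_betw_combine) auto
  moreover have "{1..?k} \<union> {?k + 1..card ?V} = {1..card ?V}" using le by auto
  moreover have "S \<union> (?V - S) = ?V" using assms by auto
  ultimately have "labelling G v" by (simp add: labelling_def)
  moreover have "v i \<in> S \<longleftrightarrow> i \<le> ?k" if "i \<in> {1..card ?V}" for i
  proof (cases "i \<le> ?k")
    case True
    then show ?thesis using that bij_betwE[OF v1] by auto
  next
    case False
    then have "v i \<in> ?V - S" using that bij_betwE[OF v2] by auto
    then show ?thesis using False by auto
  qed
  ultimately show ?thesis using that by blast
qed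

lemma connected_if_simple_spectrum:
  assumes G: "simple_graph G" and ne: "wverts G \<noteq> {}"
    and spec: "\<And>v. labelling G v \<Longrightarrow> simple_spectrum (laplacian G v)"
  shows "connected_graph G"
proof (rule ccontr)
  let ?n = "card (wverts G)"
  have fin: "finite (wverts G)" by (rule simple_graph_finite[OF G])
  assume "\<not> connected_graph G"
  then obtain S where S: "S \<subseteq> wverts G" "S \<noteq> {}" "S \<noteq> wverts G"
    and arcs: "\<And>x y. x \<in> S \<Longrightarrow> y \<in> wverts G - S \<Longrightarrow> (x, y) \<notin> warcs G \<and> (y, x) \<notin> warcs G"
    using disconnected_vertex_set[OF G ne] by blast
  obtain v where v: "labelling G v"
    and vS: "\<And>i. i \<in> {1..?n} \<Longrightarrow> v i \<in> S \<longleftrightarrow> i \<le> card S"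
    using ex_labelling_initial_segment[OF fin S(1)] by blast
  let ?A = "map_mat complex_of_real (laplacian G v)"
  have A: "?A \<in> carrier_mat ?n ?n" by simp
  have entry: "?A $$ (i, j) = complex_of_real (laplacian G v $$ (i, j))" if "i < ?n" "j < ?n" for i j
    using that carrier_matD[OF laplacian_carrier[of G v]] by simp
  have rows: "(\<Sum>j<?n. ?A $$ (i, j)) = 0" if "i < ?n" for i
  proof -
    have "(\<Sum>j<?n. ?A $$ (i, j)) = complex_of_real (\<Sum>j<?n. laplacian G v $$ (i, j) * 1)"
      unfolding of_real_sum using that by (intro sum.cong refl) (simp add: entry)
    also have "\<dots> = 0" unfolding laplacian_row_sum[OF v that, of "\<lambda>_. 1"] by (simp add: lap_def)
    finally show ?thesis .
  qed
  have "0 < card S" "card S < ?n"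
    using S fin by (auto simp: card_gt_0_iff finite_subset intro!: psubset_card_mono)
  moreover have "?A $$ (i, j) = 0" if ij: "i < ?n" "j < ?n" "(i < card S) \<noteq> (j < card S)" for i j
  proof -
    have "v (Suc i) \<in> wverts G" "v (Suc j) \<in> wverts G"
      using ij labelling_Suc_in_verts[OF v] by auto
    moreover have "v (Suc i) \<in> S \<longleftrightarrow> v (Suc j) \<notin> S" using ij vS[of "Suc i"] vS[of "Suc j"] by auto
    ultimately have "weight G (v (Suc i)) (v (Suc j)) = 0"
      using arcs simple_graph_weight[OF G] by auto
    moreover have "i \<noteq> j" using ij by auto
    ultimately show ?thesis using ij by (simp add: entry laplacian_index)
  qed
  ultimately have "2 \<le> Polynomial.order 0 (char_poly ?A)"
    by (intro order_char_poly_block_diagonal[OF A _ _ _ rows])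
  moreover have "eigenvalue ?A 0"
    using eigenvalue_0_of_row_sums_0[OF A _ rows] fin ne by (simp add: card_gt_0_iff)
  ultimately show False using spec[OF v] unfolding simple_spectrum_def by fastforce
qed

section \<open>Twin graphs of even order\<close>

text \<open>The partition of the labels is transported along the injective labelling.\<close>

lemma twin_partition_partition_on:
  assumes v: "labelling G v" and n: "n = card (wverts G)" "even n" "2 \<le> n"
  shows "partition_on (wverts G) (twin_partition G v)"
proof -
  \<comment> \<open>the partition of the labels that \<open>v\<close> maps to the twin partition\<close>
  let ?P = "(\<lambda>i. {2 * i - 1, 2 * i}) ` {1..n div 2 - 1} \<union> {{n - 1}, {n}} :: nat set set"
  obtain m where m: "n = 2 * m" using n(2) by blast
  have P: "partition_on {1..n} ?P"
  proof (rule partition_onI)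
    show "\<Union>?P = {1..n}"
    proof
      show "{1..n} \<subseteq> \<Union>?P"
      proof
        fix x assume x: "x \<in> {1..n}"
        show "x \<in> \<Union>?P"
        proof (cases "x \<le> n - 2")
          case True
          then have "(x + 1) div 2 \<in> {1..n div 2 - 1}" using x m by auto
          moreover have "x \<in> {2 * ((x + 1) div 2) - 1, 2 * ((x + 1) div 2)}"
            using x by (cases "even x") (auto elim!: evenE oddE)
          ultimately show ?thesis by blast
        next
          case False
          then have "x = n - 1 \<or> x = n" using x by auto
          then show ?thesis by blast
        qed
      qed
    qed (use n m in auto)
    fix p q assume "p \<in> ?P" "q \<in> ?P" "p \<noteq> q"
    then show "disjnt p q" using m by (auto simp: disjnt_def) presburger+
  qed auto
  have inj: "inj_on v {1..n}" "v ` {1..n} = wverts G"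
    using v n by (auto simp: labelling_def bij_betw_def)
  have "(`) v ` ?P = twin_partition G v"
    unfolding twin_partition_def Let_def twin_cell_def n(1)[symmetric] by (auto simp: image_Un image_image)
  moreover have "{} \<notin> (`) v ` ?P" by auto
  ultimately show ?thesis using partition_on_inj_image[OF P inj(1)] inj(2) by simp
qed

lemma twins_of_twin_pair:
  assumes "C \<in> twin_pairs G" "x \<in> C" "y \<in> C" "x \<noteq> y"
  shows "twins G x y"
  using assms by (auto simp: twin_pairs_def twins_def)

lemma not_controllable_if_equal_on_twins:
  assumes G: "simple_graph G" and v: "labelling G v" and t: "twins G x y" and b: "b x = b y"
  shows "\<not> controllable (card (wverts G)) (laplacian G v) (lvec G v b)"
proof (rule not_controllable_of_almost_equitable[OF G v, where y = b])
  let ?w = "\<lambda>u. if u = x then 1 else if u = y then - 1 else 0 :: real"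
  let ?\<rho> = "insert {x, y} ((\<lambda>u. {u}) ` (wverts G - {x, y}))"
  have xy: "x \<in> wverts G" "y \<in> wverts G" "x \<noteq> y" using t by (auto simp: twins_def)
  show "almost_equitable G ((\<lambda>u. {u}) ` wverts G)"
    by (rule almost_equitable_of_twin_cells[OF G partition_on_singletons]) auto
  have "twins G y x" using t by (auto simp: twins_def)
  then show "almost_equitable G ?\<rho>"
    using t by (intro almost_equitable_of_twin_cells[OF G partition_on_pair_singletons[OF xy(1,2)]])
      auto
  show "const_on_cells ((\<lambda>u. {u}) ` wverts G) ?w" by (auto simp: const_on_cells_def)
  show "x \<in> wverts G" "?w x \<noteq> 0" using xy by auto
  show "(\<Sum>u\<in>C. ?w u) = 0" if "C \<in> ?\<rho>" for C
    using that xy by (auto split: if_splits)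
  show "const_on_cells ?\<rho> b" using b by (auto simp: const_on_cells_def)
qed simp

text \<open>The three cases of the argument: equal values on some twins, equal values on the two vertices
without a twin, or different values on all of these pairs.\<close>

lemma not_controllable_if_merged_non_twins:
  fixes b :: "'a \<Rightarrow> real"
  assumes G: "simple_graph G" and lab: "labelling G v'"
    and n: "n = card (wverts G)" "even n" "2 < n"
    and v: "twin_labelling G v"
    and \<S>: "partition_on (twin_cell v ` {1..n div 2 - 1}) \<S>"
    and aep: "almost_equitable (quotient_graph G (twin_partition G v)) (\<S> \<union> {{{v (n - 1)}, {v n}}})"
    and b: "\<And>u. u \<in> wverts G \<Longrightarrow> b u \<in> {0, 1}"
  shows "\<not> controllable (card (wverts G)) (laplacian G v') (lvec G v' b)"
proof (cases "\<exists>x y. twins G x y \<and> b x = b y")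
  case True
  then show ?thesis using not_controllable_if_equal_on_twins[OF G lab] by blast
next
  case False
  let ?V = "wverts G"
  define p q where "p = v (n - 1)" and "q = v n"
  define T where "T = twin_cell v ` {1..n div 2 - 1}"
  define \<rho> where "\<rho> = insert {p, q} (\<Union> ` \<S>)"
  have v': "labelling G v" and pairs: "twin_pairs G = T"
    using v n(1) by (auto simp: twin_labelling_def T_def)
  have P: "twin_partition G v = T \<union> {{p}, {q}}"
    by (simp add: twin_partition_def Let_def T_def p_def q_def n(1))
  have partP: "partition_on ?V (T \<union> {{p}, {q}})"
    using twin_partition_partition_on[OF v' n(1,2)] n(3) unfolding P by simp
  have fin: "finite ?V" by (rule simple_graph_finite[OF G])
  have bij: "bij_betw v {1..n} ?V" using v' n(1) by (simp add: labelling_def)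
  have pq: "p \<in> ?V" "q \<in> ?V" "p \<noteq> q"
  proof -
    show "p \<in> ?V" "q \<in> ?V" using n(3) bij_betwE[OF bij] by (auto simp: p_def q_def)
    have "n - 1 \<in> {1..n}" "n \<in> {1..n}" "n - 1 \<noteq> n" using n(3) by auto
    then show "p \<noteq> q"
      using inj_on_eq_iff[OF bij_betw_imp_inj_on[OF bij]] unfolding p_def q_def by blast
  qed
  have cellT: "\<exists>x y. C = {x, y} \<and> twins G x y" if "C \<in> T" for C
    using that unfolding pairs[symmetric] twin_pairs_def by blast
  have dis: "disjoint (T \<union> {{p}, {q}})" using partP by (simp add: partition_on_def)
  have avoid: "p \<notin> C \<and> q \<notin> C" if "C \<in> T" for C
  proof -
    obtain x y where "C = {x, y}" "x \<noteq> y" using cellT[OF \<open>C \<in> T\<close>] by (auto simp: twins_def)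
    then have "C \<noteq> {p}" "C \<noteq> {q}" by auto
    then have "C \<inter> {p} = {}" "C \<inter> {q} = {}"
      using disjointD[OF dis, of C "{p}"] disjointD[OF dis, of C "{q}"] that by blast+
    then show ?thesis by blast
  qed
  have half: "(\<Sum>u\<in>C. b u - 1 / 2) = 0" if C: "C \<in> T" for C
  proof -
    obtain x y where xy: "C = {x, y}" "twins G x y" using cellT[OF C] by blast
    then have "x \<noteq> y" "b x \<in> {0, 1}" "b y \<in> {0, 1}" "b x \<noteq> b y"
      using b False by (auto simp: twins_def)
    then show ?thesis using xy(1) by auto
  qed
  have sub: "A \<subseteq> T" if "A \<in> \<S>" for A using \<S> that by (auto simp: partition_on_def T_def)
  have avoidS: "u \<noteq> p \<and> u \<noteq> q" if "A \<in> \<S>" "u \<in> \<Union>A" for A u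
    using that sub avoid by blast
  have aepP: "almost_equitable G (T \<union> {{p}, {q}})"
  proof (rule almost_equitable_of_twin_cells[OF G partP])
    fix C x y assume "C \<in> T \<union> {{p}, {q}}" and xy: "x \<in> C" "y \<in> C" "x \<noteq> y"
    then have "C \<in> T" by blast
    then show "twins G x y" using twins_of_twin_pair xy pairs by metis
  qed
  have "almost_equitable (quotient_graph G (T \<union> {{p}, {q}})) (\<S> \<union> {{{p}, {q}}})"
    using aep by (simp only: P p_def q_def)
  from almost_equitable_lift[OF G aepP this] have aep\<rho>: "almost_equitable G \<rho>"
    by (simp add: \<rho>_def insert_commute)
  have const_\<rho>: "const_on_cells \<rho> f"
    if f: "f p = f q" "\<And>A u. A \<in> \<S> \<Longrightarrow> u \<in> \<Union>A \<Longrightarrow> f u = c" for f :: "'a \<Rightarrow> real" and c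
    unfolding const_on_cells_def
  proof (intro ballI)
    fix C x y assume "C \<in> \<rho>" and xy: "x \<in> C" "y \<in> C"
    then consider "C = {p, q}" | A where "A \<in> \<S>" "C = \<Union>A" unfolding \<rho>_def by blast
    then show "f x = f y"
    proof cases
      case 1
      then show ?thesis using xy f(1) by auto
    next
      case 2
      then show ?thesis using xy f(2)[of A x] f(2)[of A y] by simp
    qed
  qed
  show ?thesis
  proof (cases "b p = b q")
    case True
    let ?w = "\<lambda>u. if u = p then 1 else if u = q then - 1 else 0 :: real"
    let ?y = "\<lambda>u. if u = p \<or> u = q then b p else 1 / 2"
    show ?thesis
    proof (rule not_controllable_of_almost_equitable[OF G lab aepP aep\<rho>])
      show "const_on_cells (T \<union> {{p}, {q}}) ?w"
        using avoid by (auto simp: const_on_cells_def)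
      show "(\<Sum>u\<in>C. ?w u) = 0" if "C \<in> \<rho>" for C
        using that unfolding \<rho>_def
      proof (elim insertE imageE)
        assume "C = {p, q}" then show ?thesis using pq by simp
      next
        fix A assume "C = \<Union>A" "A \<in> \<S>"
        then show ?thesis using avoidS by (intro sum.neutral) auto
      qed
      show "p \<in> ?V" "?w p \<noteq> 0" using pq by auto
      show "const_on_cells \<rho> ?y" by (rule const_\<rho>[of _ "1 / 2"]) (use avoidS in auto)
      show "(\<Sum>u\<in>C. b u - ?y u) = 0" if "C \<in> T \<union> {{p}, {q}}" for C
      proof (cases "C \<in> T")
        case True
        have "(\<Sum>u\<in>C. b u - ?y u) = (\<Sum>u\<in>C. b u - 1 / 2)"
          using avoid[OF True] by (intro sum.cong refl) auto
        then show ?thesis using half[OF True] by simp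
      next
        case False
        then show ?thesis using that \<open>b p = b q\<close> by auto
      qed
    qed
  next
    case False
    \<comment> \<open>\<open>n\<close> on the two vertices \<open>p\<close>, \<open>q\<close> balances \<open>-2\<close> on all \<open>n\<close> vertices\<close>
    let ?w = "\<lambda>u. (if u \<in> {p, q} then real n else 0) - 2"
    show ?thesis
    proof (rule not_controllable_of_almost_equitable[OF G lab aep\<rho>])
      show "almost_equitable G {?V}" using pq by (intro almost_equitable_trivial) auto
      show "const_on_cells \<rho> ?w" by (rule const_\<rho>[of _ "- 2"]) (use avoidS in auto)
      have "(\<Sum>u\<in>?V. if u \<in> {p, q} then real n else 0) = (\<Sum>u\<in>?V \<inter> {p, q}. real n)"
        using fin by (simp only: sum.inter_restrict)
      also have "\<dots> = 2 * real n" using pq by (simp add: Int_absorb1)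
      finally show "(\<Sum>u\<in>C. ?w u) = 0" if "C \<in> {?V}" for C
        using that n(1) by (simp add: sum_subtractf)
      show "p \<in> ?V" "?w p \<noteq> 0" using pq n(3) by auto
      show "const_on_cells {?V} (\<lambda>_. 1 / 2 :: real)" by (simp add: const_on_cells_def)
      show "(\<Sum>u\<in>C. b u - 1 / 2) = 0" if "C \<in> \<rho>" for C
        using that unfolding \<rho>_def
      proof (elim insertE imageE)
        assume "C = {p, q}"
        moreover have "b p \<in> {0, 1}" "b q \<in> {0, 1}" using b pq by auto
        ultimately show ?thesis using pq False by auto
      next
        fix A assume C: "C = \<Union>A" "A \<in> \<S>"
        have "partition_on C A"
          unfolding C(1) partition_on_def
        proof (intro conjI)
          show "disjoint A" using dis sub[OF C(2)] by (auto intro: pairwise_subset)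
          show "{} \<notin> A" using partP sub[OF C(2)] unfolding partition_on_def by blast
        qed simp
        moreover have "C \<subseteq> ?V"
          using partition_onD1[OF partP] sub[OF C(2)] unfolding C(1) by blast
        ultimately have "(\<Sum>u\<in>C. b u - 1 / 2) = (\<Sum>D\<in>A. \<Sum>u\<in>D. b u - 1 / 2)"
          using fin by (intro sum_over_cells) (auto intro: finite_subset)
        also have "\<dots> = 0" using half sub[OF C(2)] by (intro sum.neutral) blast
        finally show ?thesis .
      qed
    qed
  qed
qed

text \<open>On two vertices, the vertices are always twins, whereas a twin graph of order \<open>2\<close> would have no
twins. On the empty graph the required number of twins is negative.\<close>

lemma twin_graph_even_order_gt_2:
  assumes G: "twin_graph G" and v: "twin_labelling G v" and "even (card (wverts G))"
  shows "2 < card (wverts G)"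
proof (rule ccontr)
  let ?n = "card (wverts G)"
  assume "\<not> 2 < ?n"
  then have "?n = 0 \<or> ?n = 2" using assms(3) by (cases "?n = 1") auto
  then show False
  proof
    assume "?n = 0"
    then show False using G by (simp add: twin_graph_def)
  next
    assume n: "?n = 2"
    have simple: "simple_graph G" using G by (simp add: twin_graph_def)
    have bij: "bij_betw v {1..2} (wverts G)"
      using v n by (simp add: twin_labelling_def labelling_def)
    have V: "wverts G = {v 1, v 2}"
    proof -
      have "{1..2} = {1, 2 :: nat}" by auto
      then show ?thesis using bij by (auto simp: bij_betw_def)
    qed
    have "v 1 \<noteq> v 2" using bij_betw_imp_inj_on[OF bij] inj_onD[of v "{1..2}" 1 2] by auto
    moreover have "neighbours G (v 1) \<subseteq> {v 2}" "neighbours G (v 2) \<subseteq> {v 1}"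
      using simple_graph_arc_verts[OF simple] simple_graph_loopfree[OF simple] V
      by (auto simp: neighbours_def)
    ultimately have "twins G (v 1) (v 2)" unfolding twins_def using V by blast
    then have "{v 1, v 2} \<in> twin_pairs G" by (auto simp: twin_pairs_def)
    then show False using v n by (simp add: twin_labelling_def)
  qed
qed

lemma lvec_surj:
  assumes v: "labelling G v" and b: "b \<in> carrier_vec (card (wverts G))"
  obtains f where "lvec G v f = b" "\<And>u. u \<in> wverts G \<Longrightarrow> \<exists>i<card (wverts G). f u = b $ i"
proof
  let ?n = "card (wverts G)"
  let ?f = "\<lambda>u. b $ (inv_into {1..?n} v u - 1)"
  have bij: "bij_betw v {1..?n} (wverts G)" using v by (simp add: labelling_def)
  show "lvec G v ?f = b"
  proof (rule eq_vecI)
    fix i assume "i < dim_vec b"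
    then have "i < ?n" using b by simp
    moreover from this have "inv_into {1..?n} v (v (Suc i)) = Suc i"
      using bij by (intro inv_into_f_f) (auto simp: bij_betw_def)
    ultimately show "lvec G v ?f $ i = b $ i" by (simp add: lvec_def)
  qed (use b in \<open>simp add: lvec_def\<close>)
  fix u assume "u \<in> wverts G"
  then have "inv_into {1..?n} v u \<in> {1..?n}"
    using bij by (intro inv_into_into) (simp add: bij_betw_def)
  then show "\<exists>i<?n. ?f u = b $ i" by (intro exI[of _ "inv_into {1..?n} v u - 1"]) auto
qed

theorem mainTheorem1:
  fixes G :: "'a wdigraph" and v :: "nat \<Rightarrow> 'a" and n t :: nat
    and \<S> :: "'a set set set"
  assumes "twin_graph G"
    and "n = card (wverts G)" and "even n" and "t = n div 2 - 1"
    and "twin_labelling G v"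
    and "partition_on (twin_cell v ` {1..t}) \<S>"
    and "almost_equitable (quotient_graph G (twin_partition G v))
           (\<S> \<union> {{{v (n - 1)}, {v n}}})"
  shows "strongly_uncontrollable G"
proof -
  have G: "simple_graph G"
    and spec: "\<And>v'. labelling G v' \<Longrightarrow> simple_spectrum (laplacian G v')"
    using assms(1) by (auto simp: twin_graph_def)
  have n: "2 < n" using twin_graph_even_order_gt_2[OF assms(1,5)] assms(2,3) by simp
  then have "wverts G \<noteq> {}" using assms(2) by auto
  then have conn: "connected_graph G" by (rule connected_if_simple_spectrum[OF G _ spec])
  have "\<not> controllable (card (wverts G)) (laplacian G v') b"
    if v': "labelling G v'" and b: "b \<in> carrier_vec (card (wverts G))"
      and binary: "\<forall>i < card (wverts G). b $ i \<in> {0, 1}" for v' b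
  proof -
    obtain f where f: "lvec G v' f = b"
      and range: "\<And>u. u \<in> wverts G \<Longrightarrow> \<exists>i<card (wverts G). f u = b $ i"
      using lvec_surj[OF v' b] by blast
    have "f u \<in> {0, 1}" if "u \<in> wverts G" for u using range[OF that] binary by auto
    then show ?thesis
      using not_controllable_if_merged_non_twins[OF G v' assms(2,3) n assms(5)
          assms(6)[unfolded assms(4)] assms(7)] f by metis
  qed
  then show ?thesis using G conn spec by (auto simp: strongly_uncontrollable_def)
qed

end
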